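(* For all nonnegative integers $n$ and all complex numbers $z$, $$\sum_{k=0}^{[n/4]}(-1)^k \binom{n}{4k}\frac{B_{n-4k}(z)}{2^{6k}}=\frac{1}{2^{n+1}}\sum_{k=0}^{n}(-1)^k\frac{1+i^k}{(1+i)^k}\binom{n}{k}B_{n-k}(2z),$$ where $i$ is the imaginary unit.
   Context: The Bernoulli polynomials $B_n(z)$ ($n=0,1,2,\dots$; $z\in\mathbb{C}$) are defined by $\frac{t e^{zt}}{e^t-1}=\sum_{n=0}^\infty B_n(z)\frac{t^n}{n!}$ for $|t|<2\pi$. Here $[x]$ denotes the integer part (floor) of $x$. *)

theory Defs
  imports "HOL-Complex_Analysis.Complex_Analysis"
begin

text \<open>
  The sequence \<open>b\<close> consists of the coefficients in the expansion
  \<open>t e\<^sup>z\<^sup>t / (e\<^sup>t - 1) = (\<Sum>n. b n * t ^ n / n!)\<close> for \<open>\<bar>t\<bar> < 2\<pi>\<close>. The point \<open>t = 0\<close> is a removable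
  singularity of the left-hand side; it is excluded because HOL evaluates \<open>0 / 0\<close> to \<open>0\<close>,
  whereas the limit there is \<open>1\<close>.
\<close>
definition bernpoly_expansion :: "complex \<Rightarrow> (nat \<Rightarrow> complex) \<Rightarrow> bool" where
  "bernpoly_expansion z b \<longleftrightarrow>
     (\<forall>t::complex. t \<noteq> 0 \<and> norm t < 2 * pi \<longrightarrow>
        (\<lambda>n. b n * (t ^ n / fact n)) sums (t * exp (z * t) / (exp t - 1)))"

definition bernpoly :: "nat \<Rightarrow> complex \<Rightarrow> complex" where
  "bernpoly n z = (THE b. bernpoly_expansion z b) n"

lemma bernpoly_expansion_exists: "\<exists>b. bernpoly_expansion z b"
proof -
  define f where "f = (\<lambda>t::complex. if t = 0 then 1 else t * exp (z * t) / (exp t - 1))"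
  have nz: "exp t - 1 \<noteq> 0" if "t \<noteq> 0" "norm t < 2 * pi" for t :: complex
  proof
    assume "exp t - 1 = 0"
    then obtain n :: int where n: "Re t = 0" "Im t = of_int (2 * n) * pi"
      by (auto simp: exp_eq_1)
    have "n \<noteq> 0" using n that(1) by (auto simp: complex_eq_iff)
    then have "\<bar>real_of_int n\<bar> \<ge> 1" by linarith
    then have "2 * pi * 1 \<le> 2 * pi * \<bar>real_of_int n\<bar>" by (intro mult_left_mono) auto
    also have "\<dots> = \<bar>Im t\<bar>" using n by (simp add: abs_mult)
    also have "\<dots> \<le> norm t" by (rule abs_Im_le_cmod)
    finally show False using that by simp
  qed
  have lim: "f \<midarrow>0\<rightarrow> 1"
  proof -
    have "((exp :: complex \<Rightarrow> complex) has_field_derivative 1) (at 0)"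
      using DERIV_exp[of "0::complex"] by simp
    then have "(\<lambda>t::complex. (exp t - 1) / t) \<midarrow>0\<rightarrow> 1"
      by (simp add: has_field_derivative_iff)
    then have "(\<lambda>t::complex. exp (z * t) / ((exp t - 1) / t)) \<midarrow>0\<rightarrow> exp (z * 0) / 1"
      by (intro tendsto_intros) auto
    then have "(\<lambda>t::complex. t * exp (z * t) / (exp t - 1)) \<midarrow>0\<rightarrow> 1"
      by (simp add: mult.commute)
    then show ?thesis
      by (rule Lim_transform_eventually) (auto simp: f_def eventually_at intro!: exI[of _ 1])
  qed
  have hol: "f holomorphic_on ball 0 (2 * pi) - {0}"
  proof (rule holomorphic_transform)
    show "(\<lambda>t. t * exp (z * t) / (exp t - 1)) holomorphic_on ball 0 (2 * pi) - {0}"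
      using nz by (intro holomorphic_intros) auto
  qed (auto simp: f_def)
  have "isCont f x" if "x \<in> ball 0 (2 * pi)" for x
  proof (cases "x = 0")
    case True
    then show ?thesis using lim by (simp add: isCont_def f_def)
  next
    case False
    then show ?thesis
      using hol that by (intro continuous_on_interior[OF holomorphic_on_imp_continuous_on[OF hol]])
        (simp add: interior_open open_Diff)
  qed
  then have "continuous_on (ball 0 (2 * pi)) f"
    by (simp add: continuous_at_imp_continuous_on)
  then have "f holomorphic_on ball 0 (2 * pi)"
    by (rule no_isolated_singularity[where K = "{0}"]) (use hol in auto)
  from holomorphic_power_series[OF this]
  have "(\<lambda>n. (deriv ^^ n) f 0 * (t ^ n / fact n)) sums f t" if "norm t < 2 * pi" for t
    using that by (simp add: field_simps)
  moreover have "f t = t * exp (z * t) / (exp t - 1)" if "t \<noteq> 0" for t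
    using that by (simp add: f_def)
  ultimately have "bernpoly_expansion z (\<lambda>n. (deriv ^^ n) f 0)"
    unfolding bernpoly_expansion_def by metis
  then show ?thesis by (rule exI[where P = "bernpoly_expansion z"])
qed

lemma bernpoly_expansion_unique:
  assumes "bernpoly_expansion z a" "bernpoly_expansion z b"
  shows "a = b"
proof -
  define c where "c = (\<lambda>n. (a n - b n) / fact n)"
  have c: "(\<lambda>n. c n * t ^ n) sums 0" if "t \<noteq> 0" "norm t < 2 * pi" for t
    using sums_diff[OF assms(1)[unfolded bernpoly_expansion_def, rule_format, of t]
      assms(2)[unfolded bernpoly_expansion_def, rule_format, of t]] that
    by (simp add: c_def algebra_simps diff_divide_distrib)
  have "((\<lambda>_. 0) \<longlongrightarrow> c 0) (at (0::complex))"
    by (rule powser_limit_0_strong[of "2 * pi" c]) (use c in auto)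
  then have c0: "c 0 = 0" by (metis tendsto_const_iff trivial_limit_at)
  have c': "(\<lambda>n. c n * t ^ n) sums 0" if "norm t < 2 * pi" for t
    using c[of t] that c0 powser_sums_zero[of c] by (cases "t = 0") auto
  have "c m = 0" for m
  proof (rule ccontr)
    assume "c m \<noteq> 0"
    then have "m > 0" using c0 by (cases m) auto
    have "0 < 2 * pi" by simp
    from powser_0_nonzero[OF this, of 0 c "\<lambda>_. 0" m] c' \<open>c m \<noteq> 0\<close> \<open>m > 0\<close>
    have "\<exists>s>0. \<forall>t\<in>cball 0 s - {0 :: complex}. (0::complex) \<noteq> 0"
      by (metis diff_zero)
    then obtain s where s: "s > 0" "\<forall>t\<in>cball 0 s - {0 :: complex}. False" by blast
    then have "complex_of_real s \<in> cball 0 s - {0}" by simp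
    with s(2) show False by blast
  qed
  then show ?thesis by (auto simp: c_def)
qed

lemma bernpoly_expansion_bernpoly: "bernpoly_expansion z (\<lambda>n. bernpoly n z)"
  unfolding bernpoly_def
  using theI'[of "bernpoly_expansion z"] bernpoly_expansion_exists bernpoly_expansion_unique
  by metis

end

(* Both sides are binomial convolutions, so it suffices to compare exponential generating
   functions. With c = (1 + i) / 4 these are

     t e^(zt) / (e^t - 1) * (e^(ct) + e^(ict) + e^(-ct) + e^(-ict)) / 4   and
     (t/2) e^(zt) / (e^(t/2) - 1) * (e^(ict) + e^(-ct)) / 2,

   and they agree because e^t - 1 = (e^(t/2) - 1) (e^(t/2) + 1), 1/2 + ic = c and 1/2 - c = -ic. *)

theory Submission
  imports Defs
begin

text \<open>The exponential generating function is taken as a formal series, so that it can be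
  multiplied, rescaled and cancelled algebraically; convergence matters only for
  \<open>bernpoly_fps_mult\<close>.\<close>

definition bernpoly_fps :: "complex \<Rightarrow> complex fps" where
  "bernpoly_fps z = Abs_fps (\<lambda>n. bernpoly n z / fact n)"

lemma bernpoly_fps_nth [simp]: "fps_nth (bernpoly_fps z) n = bernpoly n z / fact n"
  by (simp add: bernpoly_fps_def)

lemma bernpoly_fps_sums:
  assumes "t \<noteq> 0" "norm t < 2 * pi"
  shows "(\<lambda>n. fps_nth (bernpoly_fps z) n * t ^ n) sums (t * exp (z * t) / (exp t - 1))"
  using bernpoly_expansion_bernpoly[of z] assms by (simp add: bernpoly_expansion_def)

text \<open>Clearing the denominator in the defining expansion gives an equality of functions on the
  disc of radius \<open>2 * pi\<close>. Both sides are analytic at 0, so their power series there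
  coincide.\<close>

lemma bernpoly_fps_mult: "bernpoly_fps z * (fps_exp 1 - 1) = fps_X * fps_exp z"
proof -
  \<comment> \<open>Convergence at the single point 1, which lies inside the disc, already forces a
    radius of convergence of at least 1.\<close>
  have summable: "summable (\<lambda>n. fps_nth (bernpoly_fps z) n * 1 ^ n)"
    using bernpoly_fps_sums[of 1 z] pi_gt3 sums_summable by fastforce
  have "fps_conv_radius (bernpoly_fps z) > 0"
    using conv_radius_geI[OF summable] unfolding fps_conv_radius_def
    by (rule order.strict_trans2[rotated]) simp
  then have "eval_fps (bernpoly_fps z) has_fps_expansion bernpoly_fps z"
    by (rule eval_fps_has_fps_expansion)
  moreover have "(\<lambda>t. exp t) has_fps_expansion fps_exp (1::complex)"
    using has_fps_expansion_exp[of "1::complex"] by simp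
  ultimately have left: "(\<lambda>t. eval_fps (bernpoly_fps z) t * (exp t - 1)) has_fps_expansion
      bernpoly_fps z * (fps_exp 1 - 1)"
    by (intro fps_expansion_intros)
  have right: "(\<lambda>t. t * exp (z * t)) has_fps_expansion fps_X * fps_exp z"
    by (intro fps_expansion_intros)
  have eq: "eval_fps (bernpoly_fps z) t * (exp t - 1) = t * exp (z * t)"
    if "norm t < 2 * pi" for t :: complex
  \<comment> \<open>The expansion says nothing at \<open>t = 0\<close>, and the denominator must not
    vanish. Zeros of \<open>exp t - 1\<close> are multiples of \<open>2 * pi * \<i>\<close>, so only
    \<open>t = 0\<close> is exceptional in the disc, and there both sides are 0.\<close>
  proof (cases "exp t = 1 \<or> t = 0")
    case False
    then show ?thesis
      using bernpoly_fps_sums[of t z] that by (simp add: eval_fps_def sums_iff)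
  next
    case True
    have "t = 0"
    proof (rule ccontr)
      assume "t \<noteq> 0"
      with True obtain n :: int where n: "Re t = 0" "Im t = of_int (2 * n) * pi"
        by (auto simp: exp_eq_1)
      then have "\<bar>2 * n\<bar> * pi = norm t" by (simp add: cmod_eq_Im abs_mult)
      then have "\<bar>real_of_int (2 * n)\<bar> * pi < 2 * pi" using that by simp
      then have "\<bar>n\<bar> < 1" by (simp only: mult_less_cancel_right_pos[OF pi_gt_zero])
      then show False using n \<open>t \<noteq> 0\<close> by (simp add: complex_eq_iff)
    qed
    then show ?thesis by simp
  qed
  have "eventually (\<lambda>t::complex. t \<in> ball 0 (2 * pi)) (nhds 0)"
    by (intro eventually_nhds_in_open) auto
  then have "eventually (\<lambda>t. eval_fps (bernpoly_fps z) t * (exp t - 1) = t * exp (z * t)) (nhds 0)"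
    by eventually_elim (simp add: eq)
  with left have "(\<lambda>t. t * exp (z * t)) has_fps_expansion bernpoly_fps z * (fps_exp 1 - 1)"
    using has_fps_expansion_cong[OF _ refl] by metis
  with right show ?thesis
    using fps_expansion_unique_complex by blast
qed

text \<open>This is \<open>bernpoly_fps_mult\<close> at \<open>2 * z\<close> after replacing X by
  X/2, which turns \<open>fps_exp (2 * z)\<close> into \<open>fps_exp z\<close>.\<close>

lemma fps_compose_bernpoly_half_mult:
  "(bernpoly_fps (2 * z) oo (fps_const (1/2) * fps_X)) * (fps_exp (1/2) - 1) =
     fps_const (1/2) * fps_X * fps_exp z"
proof -
  have "(bernpoly_fps (2 * z) * (fps_exp 1 - 1)) oo (fps_const (1/2) * fps_X) =
      (fps_X * fps_exp (2 * z)) oo (fps_const (1/2) * fps_X)"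
    by (simp only: bernpoly_fps_mult)
  then show ?thesis
    by (simp add: fps_compose_mult_distrib fps_compose_sub_distrib)
qed

lemma bernpoly_fps_identity:
  defines "c \<equiv> (1 + \<i>) / 4"
  shows "bernpoly_fps z * (fps_const (1/4) *
           (fps_exp c + fps_exp (\<i> * c) + fps_exp (- c) + fps_exp (- \<i> * c))) =
         fps_const (1/2) * (bernpoly_fps (2 * z) oo (fps_const (1/2) * fps_X)) *
           (fps_exp (\<i> * c) + fps_exp (- c))"
    (is "?B * (_ * ?C) = _ * ?B' * ?A")
proof -
  define E where "E = fps_exp (1/2 :: complex)"
  have "E * fps_exp (\<i> * c) = fps_exp c" "E * fps_exp (- c) = fps_exp (- \<i> * c)"
    unfolding E_def fps_exp_add_mult[symmetric] by (simp_all add: c_def complex_eq_iff)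
  then have C: "(E + 1) * ?A = ?C"
    by (simp add: algebra_simps)
  have E2: "fps_exp 1 - 1 = (E - 1) * (E + 1)"
    unfolding E_def by (simp add: algebra_simps flip: fps_exp_add_mult)
  \<comment> \<open>Instead of forming quotients, both sides are multiplied by
    \<open>fps_exp 1 - 1\<close>. This series is nonzero, having linear coefficient 1, and can be
    cancelled at the end.\<close>
  have "(?B * (fps_const (1/4) * ?C)) * (fps_exp 1 - 1) =
      (?B * (fps_exp 1 - 1)) * (fps_const (1/4) * ?C)"
    by (simp only: mult_ac)
  also have "\<dots> = (fps_const (1/2) * fps_const (1/2)) * fps_X * fps_exp z * ?C"
    by (simp add: bernpoly_fps_mult mult_ac)
  also have "\<dots> = fps_const (1/2) * (fps_const (1/2) * fps_X * fps_exp z) * ?C"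
    by (simp only: mult.assoc)
  also have "\<dots> = fps_const (1/2) * (?B' * (E - 1)) * ((E + 1) * ?A)"
    unfolding C unfolding E_def fps_compose_bernpoly_half_mult ..
  also have "\<dots> = (fps_const (1/2) * ?B' * ?A) * (fps_exp 1 - 1)"
    unfolding E2 by (simp only: mult_ac)
  finally have *: "(?B * (fps_const (1/4) * ?C)) * (fps_exp 1 - 1) =
      (fps_const (1/2) * ?B' * ?A) * (fps_exp 1 - 1)" .
  have "fps_nth (fps_exp 1 - 1 :: complex fps) 1 \<noteq> 0" by simp
  then have "fps_exp 1 - 1 \<noteq> (0 :: complex fps)" by fastforce
  with * show ?thesis by simp
qed

text \<open>Each fourth root of unity has powers depending only on the exponent mod 4, leaving four
  cases. The sum is the filter that keeps every fourth coefficient of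
  \<open>fps_exp c\<close>.\<close>

lemma sum_fourth_roots_unity_power:
  "1 + \<i> ^ m + (- 1) ^ m + (- \<i>) ^ m = (if 4 dvd m then 4 else 0)"
proof -
  have m: "m = 4 * (m div 4) + m mod 4" by simp
  have "(x :: complex) ^ m = x ^ (m mod 4)" if "x ^ 4 = 1" for x
    by (subst m, unfold power_add power_mult that) simp
  then have "1 + \<i> ^ m + (- 1) ^ m + (- \<i>) ^ m =
      1 + \<i> ^ (m mod 4) + (- 1) ^ (m mod 4) + (- \<i>) ^ (m mod 4)"
    by (simp add: power4_eq_xxxx)
  also have "\<dots> = (if m mod 4 = 0 then 4 else 0)"
  proof -
    have "m mod 4 = 0 \<or> m mod 4 = 1 \<or> m mod 4 = 2 \<or> m mod 4 = 3" by linarith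
    then show ?thesis
      by (elim disjE) (simp_all only:, simp_all add: power3_eq_cube)
  qed
  finally show ?thesis unfolding dvd_eq_mod_eq_0 .
qed

text \<open>Multiplication by \<open>d\<close> maps the indices up to \<open>n div d\<close>
  injectively onto the multiples of \<open>d\<close> up to \<open>n\<close>; all other terms
  vanish.\<close>

lemma sum_multiples:
  fixes f :: "nat \<Rightarrow> 'a :: comm_monoid_add"
  assumes "d > 0" and "\<And>m. m \<le> n \<Longrightarrow> \<not> d dvd m \<Longrightarrow> f m = 0"
  shows "(\<Sum>m=0..n. f m) = (\<Sum>k=0..n div d. f (d * k))"
proof -
  have "(\<Sum>k=0..n div d. f (d * k)) = sum f ((*) d ` {0..n div d})"
    using assms(1) by (subst sum.reindex) (auto simp: inj_on_def)
  also have "\<dots> = (\<Sum>m=0..n. f m)"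
  proof (rule sum.mono_neutral_left)
    show "(*) d ` {0..n div d} \<subseteq> {0..n}"
      using assms(1) by (auto simp: less_eq_div_iff_mult_less_eq mult.commute)
    show "\<forall>m\<in>{0..n} - (*) d ` {0..n div d}. f m = 0"
    proof
      fix m assume m: "m \<in> {0..n} - (*) d ` {0..n div d}"
      have "\<not> d dvd m"
      proof
        assume "d dvd m"
        then have "m = d * (m div d)" by simp
        with m show False by (auto simp: div_le_mono)
      qed
      with m show "f m = 0" using assms(2) by simp
    qed
  qed simp
  finally show ?thesis ..
qed

theorem theorem2p6:
  fixes n :: nat and z :: complex
  shows "(\<Sum>k=0..n div 4. (-1) ^ k * of_nat (n choose (4 * k)) * (bernpoly (n - 4 * k) z / 2 ^ (6 * k))) =
         1 / 2 ^ (n + 1) *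
           (\<Sum>k=0..n. (-1) ^ k * ((1 + \<i> ^ k) / (1 + \<i>) ^ k) * of_nat (n choose k) * bernpoly (n - k) (2 * z))"
proof -
  define c :: complex where "c = (1 + \<i>) / 4"
  define C where "C = fps_const (1/4) *
    (fps_exp c + fps_exp (\<i> * c) + fps_exp (- c) + fps_exp (- \<i> * c))"
  define A where "A = fps_exp (\<i> * c) + fps_exp (- c)"
  define B' where "B' = bernpoly_fps (2 * z) oo (fps_const (1/2) * fps_X)"
  \<comment> \<open>Since (1 + i)^4 = -4, this is -4/256; it is the source of the sign and of
    \<open>2 ^ (6 * k)\<close> on the left-hand side.\<close>
  have c4: "c ^ 4 = - 1 / 2 ^ 6"
    by (simp add: c_def power4_eq_xxxx field_simps complex_eq_iff)
  have C_nth: "fps_nth C m = (if 4 dvd m then c ^ m / fact m else 0)" for m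
  proof -
    have "fps_nth C m = c ^ m * (1 + \<i> ^ m + (- 1) ^ m + (- \<i>) ^ m) / (4 * fact m)"
      by (simp add: C_def power_mult_distrib power_minus[of c] power_minus[of "\<i> * c"]
          power_minus[of \<i>] add_divide_distrib algebra_simps)
    then show ?thesis by (simp add: sum_fourth_roots_unity_power)
  qed
  have A_nth: "fps_nth A k = (- 1) ^ k * ((1 + \<i> ^ k) / (1 + \<i>) ^ k) / 2 ^ k / fact k" for k
  proof -
    define w where "w = 1 + \<i>"
    have w: "w \<noteq> 0" by (simp add: w_def complex_eq_iff)
    \<comment> \<open>From (1 + i)^2 = 2i. It moves 1 + i into the denominator: the exponents
      \<open>\<i> * c\<close> and \<open>- c\<close> become -1/(2w) and -i/(2w).\<close>
    have "w * (2 * c) = \<i>" by (simp add: w_def c_def complex_eq_iff)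
    then have c: "c = \<i> / (2 * w)" using w by (simp add: field_simps)
    have "fps_nth A k = (((- 1) / (2 * w)) ^ k + ((- \<i>) / (2 * w)) ^ k) / fact k"
      by (simp add: A_def c flip: add_divide_distrib)
    also have "\<dots> = (- 1) ^ k * ((1 + \<i> ^ k) / w ^ k) / 2 ^ k / fact k"
      unfolding power_divide power_mult_distrib power_minus[of \<i>] using w by (simp add: field_simps)
    finally show ?thesis unfolding w_def .
  qed
  have B'_nth: "fps_nth B' m = bernpoly m (2 * z) / (2 ^ m * fact m)" for m
    by (simp add: B'_def power_divide)
  have "(\<Sum>k=0..n div 4. (-1) ^ k * of_nat (n choose (4 * k)) *
      (bernpoly (n - 4 * k) z / 2 ^ (6 * k))) =
      (\<Sum>k=0..n div 4. fact n * (fps_nth C (4 * k) * fps_nth (bernpoly_fps z) (n - 4 * k)))"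
  proof (rule sum.cong)
    fix k assume "k \<in> {0..n div 4}"
    then have "4 * k \<le> n" by auto
    moreover have "fps_nth C (4 * k) = (- 1) ^ k / 2 ^ (6 * k) / fact (4 * k)"
      unfolding C_nth power_mult c4 power_divide by simp
    ultimately show "(-1) ^ k * of_nat (n choose (4 * k)) * (bernpoly (n - 4 * k) z / 2 ^ (6 * k)) =
        fact n * (fps_nth C (4 * k) * fps_nth (bernpoly_fps z) (n - 4 * k))"
      by (simp add: binomial_fact mult_ac)
  qed simp
  also have "\<dots> = (\<Sum>m=0..n. fact n * (fps_nth C m * fps_nth (bernpoly_fps z) (n - m)))"
    by (rule sum_multiples[symmetric]) (auto simp: C_nth)
  also have "\<dots> = fact n * fps_nth (bernpoly_fps z * C) n"
    by (simp add: mult.commute[of _ C] fps_mult_nth sum_distrib_left)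
  also have "bernpoly_fps z * C = fps_const (1/2) * (A * B')"
    using bernpoly_fps_identity[of z] by (simp only: C_def A_def B'_def c_def mult_ac)
  also have "fact n * fps_nth \<dots> n = (\<Sum>k=0..n. fact n * (1/2 * (fps_nth A k * fps_nth B' (n - k))))"
    unfolding fps_mult_left_const_nth unfolding fps_mult_nth sum_distrib_left ..
  also have "\<dots> = (\<Sum>k=0..n. 1 / 2 ^ (n + 1) * ((-1) ^ k * ((1 + \<i> ^ k) / (1 + \<i>) ^ k) *
      of_nat (n choose k) * bernpoly (n - k) (2 * z)))"
  proof (rule sum.cong)
    fix k assume "k \<in> {0..n}"
    then have k: "k \<le> n" by simp
    define q where "q = (1 + \<i> ^ k) / (1 + \<i>) ^ k"
    \<comment> \<open>The factor \<open>2 ^ k\<close> comes from \<open>A_nth\<close> and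
      \<open>2 ^ (n - k)\<close> from \<open>B'_nth\<close>; with the leading 1/2 they give
      \<open>1 / 2 ^ (n + 1)\<close>, independent of \<open>k\<close>.\<close>
    have "(2::complex) ^ n = 2 ^ k * 2 ^ (n - k)" using k by (simp flip: power_add)
    then show "fact n * (1/2 * (fps_nth A k * fps_nth B' (n - k))) =
        1 / 2 ^ (n + 1) * ((-1) ^ k * ((1 + \<i> ^ k) / (1 + \<i>) ^ k) *
          of_nat (n choose k) * bernpoly (n - k) (2 * z))"
      unfolding A_nth B'_nth q_def[symmetric] using k by (simp add: binomial_fact field_simps)
  qed simp
  finally show ?thesis by (simp only: sum_distrib_left)
qed

end
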